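(* Let $r \geq 4$ be an integer and let $m$ be an even integer with $2 \leq m \leq r+1$. Let $\mathcal{H}(r,m)$ denote the class of all connected irregular (i.e. not regular) simple graphs $H$ of order $n$ with $n \not\equiv r \pmod 2$, maximum degree $r$, and size $e$ satisfying $2e \geq rn - m$. Let $$\rho_1(r,m) = \min_{H \in \mathcal{H}(r,m)} \lambda_1(H).$$ Then $$\rho_1(r,m) = \frac{1}{2}\left(r - 2 + \sqrt{(r+2)^2 - 4m}\right),$$ and the extremal graph (the graph in $\mathcal{H}(r,m)$ attaining this minimum) is $K_{r+1-m} + \overline{M_{m/2}}$.
   Context: All graphs are finite and simple. $\lambda_1(H)$ denotes the largest eigenvalue of the adjacency matrix of $H$. The order of a graph is its number of vertices and its size is its number of edges. $K_s$ is the complete graph on $s$ vertices, $M_t$ denotes a perfect matching on $2t$ vertices (i.e. $t$ disjoint edges), $\overline{X}$ denotes the complement of a graph $X$, and $X + Y$ denotes the join of $X$ and $Y$ (disjoint union plus all edges between $X$ and $Y$).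
   Formalization: The value of ρ_1 and membership of the extremal graph in H(r,m) are asserted only for m ≤ r: at m = r+1 that graph is (r−1)-regular, hence not in H(r,m), and every member has λ_1 > r−1, the value of the formula, so the claim fails there. *)

theory Defs
  imports
    Complex_Main
    "Graph_Theory.Graph_Theory"
    "Jordan_Normal_Form.Char_Poly"
begin

text \<open>A finite simple graph is a value satisfying \<^locale>\<open>pair_graph\<close>: finite vertex set,
  symmetric irreflexive arc relation. Each undirected edge is thus a pair of opposite arcs, the
  degree of a vertex is its \<^const>\<open>out_degree\<close>, and isomorphism is \<^const>\<open>digraph_iso\<close>.\<close>

definition graph_order :: "'a pair_pre_digraph \<Rightarrow> nat" where
  "graph_order G = card (pverts G)"

definition graph_size :: "'a pair_pre_digraph \<Rightarrow> nat" where
  "graph_size G = card {{u, v} | u v. (u, v) \<in> parcs G}"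

definition degree_of :: "'a pair_pre_digraph \<Rightarrow> 'a \<Rightarrow> nat" where
  "degree_of G v = out_degree (with_proj G) v"

definition max_degree :: "'a pair_pre_digraph \<Rightarrow> nat" where
  "max_degree G = Max (degree_of G ` pverts G)"

definition regular_graph :: "'a pair_pre_digraph \<Rightarrow> bool" where
  "regular_graph G \<longleftrightarrow> (\<exists>k. \<forall>v\<in>pverts G. degree_of G v = k)"

text \<open>The adjacency matrix is taken with respect to some enumeration of the vertices; another
  enumeration conjugates it by a permutation matrix and leaves the eigenvalues unchanged.\<close>

definition vertex_enum :: "'a pair_pre_digraph \<Rightarrow> nat \<Rightarrow> 'a" where
  "vertex_enum G = (SOME f. bij_betw f {0..<graph_order G} (pverts G))"

definition adj_mat :: "'a pair_pre_digraph \<Rightarrow> real mat" where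
  "adj_mat G = mat (graph_order G) (graph_order G)
     (\<lambda>(i, j). if (vertex_enum G i, vertex_enum G j) \<in> parcs G then 1 else 0)"

text \<open>The matrix is real symmetric, so all its complex eigenvalues are real and it is enough to
  take the maximum over real ones.\<close>

definition lambda1 :: "'a pair_pre_digraph \<Rightarrow> real" where
  "lambda1 G = Max {k. eigenvalue (adj_mat G) k}"

definition complete_graph :: "nat \<Rightarrow> nat pair_pre_digraph" where
  "complete_graph s =
     \<lparr> pverts = {0..<s}, parcs = {(u, v). u < s \<and> v < s \<and> u \<noteq> v} \<rparr>"

text \<open>The edges of the matching are the pairs \<open>{2 i, 2 i + 1}\<close> with \<open>i < t\<close>.\<close>

definition matching_graph :: "nat \<Rightarrow> nat pair_pre_digraph" where
  "matching_graph t =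
     \<lparr> pverts = {0..<2 * t},
       parcs = {(u, v). u < 2 * t \<and> v < 2 * t \<and> u \<noteq> v \<and> u div 2 = v div 2} \<rparr>"

definition graph_complement :: "'a pair_pre_digraph \<Rightarrow> 'a pair_pre_digraph" where
  "graph_complement G =
     \<lparr> pverts = pverts G,
       parcs = {(u, v). u \<in> pverts G \<and> v \<in> pverts G \<and> u \<noteq> v \<and> (u, v) \<notin> parcs G} \<rparr>"

definition graph_join ::
    "'a pair_pre_digraph \<Rightarrow> 'b pair_pre_digraph \<Rightarrow> ('a + 'b) pair_pre_digraph" where
  "graph_join G H =
     \<lparr> pverts = pverts G <+> pverts H,
       parcs = map_prod Inl Inl ` parcs G \<union> map_prod Inr Inr ` parcs H
         \<union> Inl ` pverts G \<times> Inr ` pverts H \<union> Inr ` pverts H \<times> Inl ` pverts G \<rparr>"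

definition H_class :: "nat \<Rightarrow> nat \<Rightarrow> 'a pair_pre_digraph set" where
  "H_class r m = {H. pair_graph H \<and> Digraph_Component.connected (with_proj H)
     \<and> \<not> regular_graph H
     \<and> graph_order H mod 2 \<noteq> r mod 2
     \<and> max_degree H = r
     \<and> 2 * int (graph_size H) \<ge> int r * int (graph_order H) - int m}"

text \<open>Vertices are drawn from \<^typ>\<open>nat\<close>, so that every finite graph occurs up to isomorphism.
  The operator \<open>LEAST\<close> denotes a minimum: it is specified only if the minimum is attained.\<close>

definition rho1 :: "nat \<Rightarrow> nat \<Rightarrow> real" where
  "rho1 r m = (LEAST x. x \<in> lambda1 ` (H_class r m :: nat pair_pre_digraph set))"

text \<open>For \<open>m = r + 1\<close> the complete graph on the left has no vertices, and this graph is
  \<open>(r - 1)\<close>-regular; hence it belongs to \<^const>\<open>H_class\<close> only for \<open>m \<le> r\<close>.\<close>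

definition extremal_graph :: "nat \<Rightarrow> nat \<Rightarrow> (nat + nat) pair_pre_digraph" where
  "extremal_graph r m =
     graph_join (complete_graph (r + 1 - m)) (graph_complement (matching_graph (m div 2)))"

end

theory Submission
  imports Defs "HOL-Analysis.Function_Topology"
begin

text \<open>
  The number \<open>\<rho>\<close> is the larger root of \<open>(r - \<rho>) (\<rho> + 2) = m\<close>. The parity condition leaves
  \<open>n = r + 1\<close> and \<open>n \<ge> r + 3\<close>. For \<open>n \<ge> r + 3\<close> the average degree \<open>2 e / n \<ge> r - m / n\<close> already
  exceeds \<open>\<rho>\<close>. For \<open>n = r + 1\<close> the complement has degree sum at most \<open>m\<close>, so its non-isolated
  vertices lie in a set \<open>T\<close> of exactly \<open>m\<close> vertices. The vector with value \<open>\<rho> + 1\<close> on \<open>T\<close> and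
  \<open>\<rho> + 2\<close> elsewhere, which is the Perron vector of the extremal graph, has Rayleigh quotient at
  least \<open>\<rho>\<close>; if the quotient equals \<open>\<lambda>\<^sub>1 = \<rho>\<close>, the vector is an eigenvector, which forces every
  vertex of \<open>T\<close> to have degree one in the complement.
\<close>

section \<open>Rayleigh quotients of symmetric kernels\<close>

text \<open>The first variation vanishes at a maximiser. Moving \<open>z\<close> along its residual
  \<open>w\<close> changes the form minus \<open>M\<close> times the squared norm by
  \<open>2 * t * S + t\<^sup>2 * D\<close>, where \<open>S\<close> is the squared norm of
  \<open>w\<close>; for small \<open>t > 0\<close> this would be positive unless
  \<open>w = 0\<close>.\<close>

lemma quad_form_max_eigen:
  fixes a :: "'a \<Rightarrow> 'a \<Rightarrow> real"
  assumes fin: "finite V"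
    and sym: "\<And>u v. u \<in> V \<Longrightarrow> v \<in> V \<Longrightarrow> a u v = a v u"
    and le: "\<And>x. (\<Sum>u\<in>V. x u * (\<Sum>v\<in>V. a u v * x v)) \<le> M * (\<Sum>u\<in>V. (x u)\<^sup>2)"
    and eq: "(\<Sum>u\<in>V. z u * (\<Sum>v\<in>V. a u v * z v)) = M * (\<Sum>u\<in>V. (z u)\<^sup>2)"
    and u: "u \<in> V"
  shows "(\<Sum>v\<in>V. a u v * z v) = M * z u"
proof -
  define L where "L x u = (\<Sum>v\<in>V. a u v * x v)" for x u
  define w where "w u = L z u - M * z u" for u
  define D where "D = (\<Sum>u\<in>V. w u * L w u) - M * (\<Sum>u\<in>V. (w u)\<^sup>2)"
  define S where "S = (\<Sum>u\<in>V. (w u)\<^sup>2)"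
  have "(\<Sum>u\<in>V. z u * L w u) = (\<Sum>u\<in>V. \<Sum>v\<in>V. z u * (a u v * w v))"
    by (simp add: L_def sum_distrib_left)
  also have "\<dots> = (\<Sum>v\<in>V. \<Sum>u\<in>V. z u * (a u v * w v))"
    by (rule sum.swap)
  also have "\<dots> = (\<Sum>v\<in>V. w v * L z v)"
    unfolding L_def sum_distrib_left by (intro sum.cong refl) (simp add: sym)
  finally have swap: "(\<Sum>u\<in>V. z u * L w u) = (\<Sum>u\<in>V. w u * L z u)" .
  have S0: "S \<ge> 0" by (simp add: S_def sum_nonneg)
  \<comment> \<open>first-order optimality at \<open>z\<close> in the direction of the residual \<open>w\<close>\<close>
  have key: "2 * t * S + t\<^sup>2 * D \<le> 0" for t
  proof -
    have lin: "L (\<lambda>u. z u + t * w u) u = L z u + t * L w u" for u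
      by (simp add: L_def sum.distrib sum_distrib_left algebra_simps)
    have "(\<Sum>u\<in>V. (z u + t * w u) * L (\<lambda>u. z u + t * w u) u)
        = (\<Sum>u\<in>V. z u * L z u) + t * (\<Sum>u\<in>V. w u * L z u) + t * (\<Sum>u\<in>V. z u * L w u)
          + t\<^sup>2 * (\<Sum>u\<in>V. w u * L w u)"
      by (simp add: lin sum.distrib sum_distrib_left algebra_simps power2_eq_square)
    moreover have "(\<Sum>u\<in>V. (z u + t * w u)\<^sup>2)
        = (\<Sum>u\<in>V. (z u)\<^sup>2) + 2 * t * (\<Sum>u\<in>V. w u * z u) + t\<^sup>2 * (\<Sum>u\<in>V. (w u)\<^sup>2)"
      by (simp add: sum.distrib sum_distrib_left algebra_simps power2_eq_square)
    moreover have "(\<Sum>u\<in>V. w u * L z u) - M * (\<Sum>u\<in>V. w u * z u) = S"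
      by (simp add: S_def w_def sum_distrib_left sum_subtractf [symmetric] algebra_simps power2_eq_square)
    moreover have "(\<Sum>u\<in>V. (z u + t * w u) * L (\<lambda>u. z u + t * w u) u)
        \<le> M * (\<Sum>u\<in>V. (z u + t * w u)\<^sup>2)"
      using le[of "\<lambda>u. z u + t * w u"] by (simp add: L_def)
    moreover have "(\<Sum>u\<in>V. z u * L z u) = M * (\<Sum>u\<in>V. (z u)\<^sup>2)"
      using eq by (simp add: L_def)
    ultimately show ?thesis
      unfolding D_def using swap by (simp add: algebra_simps)
  qed
  have "S = 0"
  proof (rule ccontr)
    assume "S \<noteq> 0"
    with S0 have S: "S > 0" by simp
    \<comment> \<open>Small enough that \<open>t * \<bar>D\<bar> \<le> S\<close>, so the quadratic
      term cannot outweigh the linear one; the added 1 covers \<open>D = 0\<close>.\<close>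
    define t where "t = S / (\<bar>D\<bar> + 1)"
    have t: "t > 0" using S by (simp add: t_def)
    have "t * \<bar>D\<bar> \<le> S" using S by (simp add: t_def divide_simps mult_left_mono)
    moreover have "- (t * \<bar>D\<bar>) \<le> t * D" using t by (smt (verit) mult_minus_right mult_left_mono)
    ultimately have "0 < 2 * S + t * D" using S by linarith
    then have "0 < t * (2 * S + t * D)" using t by simp
    with key[of t] show False by (simp add: algebra_simps power2_eq_square)
  qed
  then have "w u = 0" using u fin by (simp add: S_def sum_nonneg_eq_0_iff)
  then show ?thesis by (simp add: w_def L_def)
qed

text \<open>The quadratic form is continuous and attains its maximum \<open>M\<close> on the compact
  unit sphere. A maximiser is an eigenvector by \<open>quad_form_max_eigen\<close>.\<close>

lemma symmetric_kernel_eigen_max: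
  fixes a :: "'a \<Rightarrow> 'a \<Rightarrow> real"
  assumes fin: "finite V" and ne: "V \<noteq> {}"
    and sym: "\<And>u v. u \<in> V \<Longrightarrow> v \<in> V \<Longrightarrow> a u v = a v u"
  obtains M z u0 where "u0 \<in> V" "z u0 \<noteq> 0"
    "\<And>u. u \<in> V \<Longrightarrow> (\<Sum>v\<in>V. a u v * z v) = M * z u"
    "\<And>x. (\<Sum>u\<in>V. x u * (\<Sum>v\<in>V. a u v * x v)) \<le> M * (\<Sum>u\<in>V. (x u)\<^sup>2)"
proof -
  define Q where "Q x = (\<Sum>u\<in>V. x u * (\<Sum>v\<in>V. a u v * x v))" for x :: "'a \<Rightarrow> real"
  define N where "N x = (\<Sum>u\<in>V. (x u)\<^sup>2)" for x :: "'a \<Rightarrow> real"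
  \<comment> \<open>coordinates outside \<open>V\<close> are pinned to \<open>0\<close>, so that the unit sphere becomes compact in the
    product topology\<close>
  define F where "F u = (if u \<in> V then {-1..1} else {0::real})" for u
  define K where "K = Pi\<^sub>E UNIV F \<inter> {x. N x = 1}"
  have coord: "continuous_on UNIV (\<lambda>x :: 'a \<Rightarrow> real. x u)" for u
    by (rule continuous_on_product_coordinates)
  have contN: "continuous_on UNIV N"
    unfolding N_def by (intro continuous_intros coord)
  have contQ: "continuous_on UNIV Q"
    unfolding Q_def by (intro continuous_intros coord)
  have "compactin (product_topology (\<lambda>_. euclidean) UNIV) (Pi\<^sub>E UNIV F)"
    by (subst compactin_PiE) (auto simp: F_def)
  then have "compact (Pi\<^sub>E UNIV F)"
    by (simp add: euclidean_product_topology)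
  moreover have "closed {x. N x = 1}"
    using contN by (intro closed_Collect_eq) auto
  ultimately have compK: "compact K" unfolding K_def by (rule compact_Int_closed)
  obtain v0 where v0: "v0 \<in> V" using ne by blast
  have "N (\<lambda>u. if u = v0 then 1 else 0) = 1"
    using v0 fin by (simp add: N_def if_distrib [of "\<lambda>x. x\<^sup>2"] cong: if_cong)
  then have "(\<lambda>u. if u = v0 then 1 else 0) \<in> K"
    using v0 by (auto simp: K_def F_def)
  then have "K \<noteq> {}" by blast
  then obtain z where z: "z \<in> K" and zmax: "\<And>x. x \<in> K \<Longrightarrow> Q x \<le> Q z"
    using continuous_attains_sup[OF compK _ continuous_on_subset[OF contQ]] by blast
  have Nz: "N z = 1" using z by (simp add: K_def)
  have le: "Q x \<le> Q z * N x" for x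
  proof (cases "N x = 0")
    case True
    then have "\<forall>u\<in>V. x u = 0" using fin by (simp add: N_def sum_nonneg_eq_0_iff)
    then show ?thesis using True by (simp add: Q_def)
  next
    case False
    have "N x \<ge> 0" by (simp add: N_def sum_nonneg)
    with False have pos: "N x > 0" by simp
    define s where "s = sqrt (N x)"
    have s: "s > 0" "s\<^sup>2 = N x" using pos by (auto simp: s_def)
    \<comment> \<open>Scaling to norm one and zeroing the coordinates outside \<open>V\<close> moves
      \<open>x\<close> into \<open>K\<close> while keeping the quotient of \<open>Q\<close> by
      \<open>N\<close>, so the bound on \<open>K\<close> holds for every \<open>x\<close>.\<close>
    define y where "y u = (if u \<in> V then x u / s else 0)" for u
    have "N y = N x / s\<^sup>2"
      by (simp add: N_def y_def power_divide sum_divide_distrib)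
    then have Ny: "N y = 1" using s pos by simp
    have "y \<in> K"
    proof -
      have "y u \<in> {-1..1}" if "u \<in> V" for u
      proof -
        have "(y u)\<^sup>2 \<le> N y"
          unfolding N_def by (rule member_le_sum) (use that fin in auto)
        then have "\<bar>y u\<bar> \<le> 1" using Ny by (simp add: abs_square_le_1)
        then show ?thesis by auto
      qed
      moreover have "y u = 0" if "u \<notin> V" for u using that by (simp add: y_def)
      ultimately show ?thesis using Ny by (auto simp: K_def F_def PiE_def Pi_def)
    qed
    moreover have "Q y = Q x / s\<^sup>2"
      by (simp add: Q_def y_def sum_divide_distrib power2_eq_square sum_distrib_left)
    ultimately have "Q x / s\<^sup>2 \<le> Q z" using zmax by metis
    then show ?thesis using s pos by (simp add: divide_simps mult.commute)
  qed
  have "\<exists>u\<in>V. z u \<noteq> 0"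
  proof (rule ccontr)
    assume "\<not> ?thesis"
    then have "N z = 0" by (simp add: N_def)
    with Nz show False by simp
  qed
  then obtain u0 where u0: "u0 \<in> V" "z u0 \<noteq> 0" by blast
  have ev: "(\<Sum>v\<in>V. a u v * z v) = Q z * z u" if "u \<in> V" for u
    using fin sym le Nz that unfolding Q_def N_def
    by (intro quad_form_max_eigen) auto
  show ?thesis
    by (rule that[OF u0 ev[unfolded Q_def] le[unfolded Q_def N_def]])
qed

section \<open>The adjacency operator\<close>

text \<open>The adjacency operator on functions of the vertices, free of the arbitrary enumeration
  behind \<open>adj_mat\<close>.\<close>

definition nbr_sum :: "'a pair_pre_digraph \<Rightarrow> ('a \<Rightarrow> real) \<Rightarrow> 'a \<Rightarrow> real" where
  "nbr_sum G x u = (\<Sum>v | (u, v) \<in> parcs G. x v)"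

lemma pair_graph_nbrs_subset:
  assumes "pair_graph G"
  shows "{v. (u, v) \<in> parcs G} \<subseteq> pverts G"
proof -
  interpret pair_graph G by fact
  show ?thesis using in_arcsD2 by blast
qed

text \<open>Kernel form of the operator, to which the results on symmetric kernels apply.\<close>

lemma nbr_sum_conv:
  assumes G: "pair_graph G"
  shows "nbr_sum G x u = (\<Sum>v\<in>pverts G. (if (u, v) \<in> parcs G then 1 else 0) * x v)"
proof -
  interpret pair_graph G by fact
  have "(\<Sum>v\<in>pverts G. (if (u, v) \<in> parcs G then 1 else 0) * x v)
      = (\<Sum>v\<in>pverts G. if (u, v) \<in> parcs G then x v else 0)"
    by (intro sum.cong) auto
  also have "\<dots> = (\<Sum>v \<in> pverts G \<inter> {v. (u, v) \<in> parcs G}. x v)"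
    by (simp add: sum.inter_restrict pair_finite_verts)
  also have "pverts G \<inter> {v. (u, v) \<in> parcs G} = {v. (u, v) \<in> parcs G}"
    using pair_graph_nbrs_subset[OF G] by blast
  finally show ?thesis by (simp add: nbr_sum_def)
qed

section \<open>From the adjacency matrix to the adjacency operator\<close>

lemma vertex_enum_bij:
  assumes "finite (pverts G)"
  shows "bij_betw (vertex_enum G) {0..<graph_order G} (pverts G)"
  using someI_ex[OF ex_bij_betw_nat_finite[OF assms]]
  by (simp add: vertex_enum_def graph_order_def)

lemma adj_mat_carrier: "adj_mat G \<in> carrier_mat (graph_order G) (graph_order G)"
  by (simp add: adj_mat_def)

lemma adj_mat_mult_vec:
  assumes G: "pair_graph G" and i: "i < graph_order G"
  shows "(adj_mat G *\<^sub>v Matrix.vec (graph_order G) (\<lambda>j. x (vertex_enum G j))) $ i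
    = nbr_sum G x (vertex_enum G i)"
proof -
  interpret pair_graph G by fact
  let ?f = "vertex_enum G"
  have "(adj_mat G *\<^sub>v Matrix.vec (graph_order G) (\<lambda>j. x (?f j))) $ i
      = (\<Sum>j\<in>{0..<graph_order G}. (if (?f i, ?f j) \<in> parcs G then 1 else 0) * x (?f j))"
    using i by (simp add: adj_mat_def scalar_prod_def)
  also have "\<dots> = (\<Sum>v\<in>pverts G. (if (?f i, v) \<in> parcs G then 1 else 0) * x v)"
    by (rule sum.reindex_bij_betw[OF vertex_enum_bij[OF pair_finite_verts]])
  finally show ?thesis by (simp add: nbr_sum_conv[OF G])
qed

text \<open>Along the enumeration, vectors of length \<open>graph_order G\<close> correspond to
  functions on the vertices, and nonzero vectors to functions that do not vanish on
  \<open>pverts G\<close>. From here on eigenvalues are handled through \<open>nbr_sum\<close>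
  alone.\<close>

lemma eigenvalue_adj_mat_iff:
  assumes G: "pair_graph G"
  shows "eigenvalue (adj_mat G) k \<longleftrightarrow>
    (\<exists>x. (\<exists>u\<in>pverts G. x u \<noteq> 0) \<and> (\<forall>u\<in>pverts G. nbr_sum G x u = k * x u))"
proof -
  interpret pair_graph G by fact
  let ?f = "vertex_enum G" and ?n = "graph_order G"
  have bij: "bij_betw ?f {0..<?n} (pverts G)"
    by (rule vertex_enum_bij[OF pair_finite_verts])
  then have surj: "pverts G = ?f ` {0..<?n}" by (simp add: bij_betw_def)
  have dim: "dim_row (adj_mat G) = ?n" by (simp add: adj_mat_def)
  have iff: "eigenvector (adj_mat G) (Matrix.vec ?n (\<lambda>j. x (?f j))) k \<longleftrightarrow>
      (\<exists>u\<in>pverts G. x u \<noteq> 0) \<and> (\<forall>u\<in>pverts G. nbr_sum G x u = k * x u)" for x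
  proof -
    have "Matrix.vec ?n (\<lambda>j. x (?f j)) \<noteq> 0\<^sub>v ?n \<longleftrightarrow> (\<exists>u\<in>pverts G. x u \<noteq> 0)"
      unfolding surj by (auto simp: vec_eq_iff)
    moreover have "adj_mat G *\<^sub>v Matrix.vec ?n (\<lambda>j. x (?f j)) = k \<cdot>\<^sub>v Matrix.vec ?n (\<lambda>j. x (?f j)) \<longleftrightarrow>
        (\<forall>u\<in>pverts G. nbr_sum G x u = k * x u)"
      unfolding surj
      by (auto simp: vec_eq_iff dim adj_mat_mult_vec[OF G] simp del: index_mult_mat_vec)
    ultimately show ?thesis by (simp add: eigenvector_def dim)
  qed
  show ?thesis
  proof
    assume "eigenvalue (adj_mat G) k"
    then obtain w where w: "eigenvector (adj_mat G) w k" by (auto simp: eigenvalue_def)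
    define x where "x u = w $ (the_inv_into {0..<?n} ?f u)" for u
    have "dim_vec w = ?n" using w by (simp add: eigenvector_def dim)
    moreover have "x (?f j) = w $ j" if "j < ?n" for j
      using that bij by (simp add: x_def bij_betw_def the_inv_into_f_f)
    ultimately have "w = Matrix.vec ?n (\<lambda>j. x (?f j))" by auto
    with w iff[of x] show "\<exists>x. (\<exists>u\<in>pverts G. x u \<noteq> 0) \<and> (\<forall>u\<in>pverts G. nbr_sum G x u = k * x u)"
      by blast
  next
    assume "\<exists>x. (\<exists>u\<in>pverts G. x u \<noteq> 0) \<and> (\<forall>u\<in>pverts G. nbr_sum G x u = k * x u)"
    with iff show "eigenvalue (adj_mat G) k" unfolding eigenvalue_def by blast
  qed
qed

text \<open>Gives meaning to the \<open>Max\<close> in \<open>lambda1\<close>: eigenvalues are roots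
  of a monic polynomial.\<close>

lemma finite_eigenvalues_adj_mat: "finite {k. eigenvalue (adj_mat G) k}"
proof -
  have "char_poly (adj_mat G) \<noteq> 0"
    using degree_monic_char_poly[OF adj_mat_carrier[of G]] by auto
  then show ?thesis
    by (simp add: eigenvalue_root_char_poly[OF adj_mat_carrier] poly_roots_finite)
qed

section \<open>Variational bounds for the largest eigenvalue\<close>

lemma lambda1_rayleigh:
  assumes G: "pair_graph G" and ne: "pverts G \<noteq> {}"
  shows "(\<Sum>u\<in>pverts G. x u * nbr_sum G x u) \<le> lambda1 G * (\<Sum>u\<in>pverts G. (x u)\<^sup>2)"
proof -
  interpret pair_graph G by fact
  have sym: "(if (u, v) \<in> parcs G then 1 else 0 :: real) = (if (v, u) \<in> parcs G then 1 else 0)" for u v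
    using arcs_symmetric by auto
  obtain M z u0 where u0: "u0 \<in> pverts G" "z u0 \<noteq> 0"
    and ev: "\<And>u. u \<in> pverts G \<Longrightarrow> nbr_sum G z u = M * z u"
    and le: "\<And>x. (\<Sum>u\<in>pverts G. x u * nbr_sum G x u) \<le> M * (\<Sum>u\<in>pverts G. (x u)\<^sup>2)"
    unfolding nbr_sum_conv[OF G]
    by (rule symmetric_kernel_eigen_max[OF pair_finite_verts ne, of "\<lambda>u v. if (u, v) \<in> parcs G then 1 else 0"])
       (use sym in auto)
  \<comment> \<open>The maximum of the quotient is itself an eigenvalue, hence at most the largest
    one.\<close>
  have "M \<le> lambda1 G"
    unfolding lambda1_def
    by (intro Max_ge finite_eigenvalues_adj_mat) (use u0 ev in \<open>auto simp: eigenvalue_adj_mat_iff[OF G]\<close>)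
  then have "M * (\<Sum>u\<in>pverts G. (x u)\<^sup>2) \<le> lambda1 G * (\<Sum>u\<in>pverts G. (x u)\<^sup>2)"
    by (intro mult_right_mono sum_nonneg) auto
  with le[of x] show ?thesis by linarith
qed

text \<open>Equality case of the Rayleigh bound; it identifies the graphs that attain the
  minimum.\<close>

lemma lambda1_rayleigh_eq:
  assumes G: "pair_graph G"
    and eq: "(\<Sum>u\<in>pverts G. x u * nbr_sum G x u) = lambda1 G * (\<Sum>u\<in>pverts G. (x u)\<^sup>2)"
    and u: "u \<in> pverts G"
  shows "nbr_sum G x u = lambda1 G * x u"
proof -
  interpret pair_graph G by fact
  have ne: "pverts G \<noteq> {}" using u by blast
  show ?thesis
    unfolding nbr_sum_conv[OF G]
    by (rule quad_form_max_eigen[OF pair_finite_verts _ lambda1_rayleigh[OF G ne, unfolded nbr_sum_conv[OF G]]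
          eq[unfolded nbr_sum_conv[OF G]] u])
       (use arcs_symmetric in auto)
qed

text \<open>Self-adjointness of the adjacency operator, from the symmetry of the arcs.\<close>

lemma nbr_sum_swap:
  assumes G: "pair_graph G"
  shows "(\<Sum>u\<in>pverts G. x u * nbr_sum G y u) = (\<Sum>u\<in>pverts G. y u * nbr_sum G x u)"
proof -
  interpret pair_graph G by fact
  have "(\<Sum>u\<in>pverts G. x u * nbr_sum G y u)
      = (\<Sum>u\<in>pverts G. \<Sum>v\<in>pverts G. x u * ((if (u, v) \<in> parcs G then 1 else 0) * y v))"
    by (simp add: nbr_sum_conv[OF G] sum_distrib_left)
  also have "\<dots> = (\<Sum>v\<in>pverts G. \<Sum>u\<in>pverts G. x u * ((if (u, v) \<in> parcs G then 1 else 0) * y v))"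
    by (rule sum.swap)
  also have "\<dots> = (\<Sum>v\<in>pverts G. y v * nbr_sum G x v)"
    unfolding nbr_sum_conv[OF G] sum_distrib_left
    by (intro sum.cong refl) (use arcs_symmetric in auto)
  finally show ?thesis .
qed

text \<open>The easy half of Perron-Frobenius. For an eigenpair \<open>l\<close>, \<open>y\<close>
  the triangle inequality bounds \<open>l * \<bar>y u\<bar>\<close> by the neighbour sum of
  \<open>\<bar>y\<bar>\<close>. Pairing with \<open>x\<close> and moving the operator onto
  \<open>x\<close> gives \<open>l * ?S \<le> k * ?S\<close>, where \<open>?S > 0\<close> because
  \<open>x\<close> is positive and \<open>y\<close> is nonzero.\<close>

lemma lambda1_eqI_positive_eigenvector:
  assumes G: "pair_graph G" and ne: "pverts G \<noteq> {}"
    and pos: "\<And>u. u \<in> pverts G \<Longrightarrow> x u > 0"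
    and ev: "\<And>u. u \<in> pverts G \<Longrightarrow> nbr_sum G x u = k * x u"
  shows "lambda1 G = k"
proof -
  interpret pair_graph G by fact
  have "l \<le> k" if l: "eigenvalue (adj_mat G) l" for l
  proof -
    obtain y u0 where u0: "u0 \<in> pverts G" "y u0 \<noteq> 0"
      and evy: "\<And>u. u \<in> pverts G \<Longrightarrow> nbr_sum G y u = l * y u"
      using l unfolding eigenvalue_adj_mat_iff[OF G] by blast
    let ?y = "\<lambda>u. \<bar>y u\<bar>" and ?S = "\<Sum>u\<in>pverts G. x u * \<bar>y u\<bar>"
    have "l * \<bar>y u\<bar> \<le> nbr_sum G ?y u" if "u \<in> pverts G" for u
    proof -
      have "l * \<bar>y u\<bar> \<le> \<bar>l * y u\<bar>" by (simp add: abs_mult mult_right_mono)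
      also have "\<dots> = \<bar>nbr_sum G y u\<bar>" using evy that by simp
      also have "\<dots> \<le> nbr_sum G ?y u" unfolding nbr_sum_def by (rule sum_abs)
      finally show ?thesis .
    qed
    then have "(\<Sum>u\<in>pverts G. x u * (l * \<bar>y u\<bar>)) \<le> (\<Sum>u\<in>pverts G. x u * nbr_sum G ?y u)"
      using pos by (intro sum_mono mult_left_mono) (auto intro: less_imp_le)
    also have "\<dots> = (\<Sum>u\<in>pverts G. ?y u * nbr_sum G x u)" by (rule nbr_sum_swap[OF G])
    also have "\<dots> = k * ?S" by (simp add: ev sum_distrib_left algebra_simps)
    finally have "l * ?S \<le> k * ?S" by (simp add: sum_distrib_left algebra_simps)
    moreover have "?S > 0"
      using pos u0 pair_finite_verts
      by (intro sum_pos2[of _ u0]) (auto simp: zero_le_mult_iff less_imp_le)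
    ultimately show ?thesis by simp
  qed
  moreover have "eigenvalue (adj_mat G) k"
    unfolding eigenvalue_adj_mat_iff[OF G] using ev pos ne by (intro exI[of _ x]) force
  ultimately show ?thesis
    unfolding lambda1_def by (intro Max_eqI finite_eigenvalues_adj_mat) auto
qed

section \<open>Degrees and the number of edges\<close>

lemma degree_of_conv: "degree_of G u = card {v. (u, v) \<in> parcs G}"
proof -
  have "out_arcs (with_proj G) u = Pair u ` {v. (u, v) \<in> parcs G}"
    by (auto simp: out_arcs_def)
  then show ?thesis
    by (simp add: degree_of_def out_degree_def card_image inj_on_def)
qed

lemma nbr_sum_one: "nbr_sum G (\<lambda>_. 1) u = real (degree_of G u)"
  by (simp add: nbr_sum_def degree_of_conv)

text \<open>Degrees count arcs while \<open>graph_size\<close> counts unordered pairs. The map from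
  \<open>(u, v)\<close> to \<open>{u, v}\<close> has fibres of size exactly two, by symmetry and the
  absence of loops.\<close>

lemma handshake:
  assumes G: "pair_graph G"
  shows "(\<Sum>u\<in>pverts G. degree_of G u) = 2 * graph_size G"
proof -
  interpret pair_graph G by fact
  let ?E = "{{u, v} | u v. (u, v) \<in> parcs G}"
  let ?e = "\<lambda>(u, v). {u, v}"
  have E: "?E = ?e ` parcs G" by (auto simp: image_iff)
  have finE: "finite ?E" unfolding E using pair_finite_arcs by blast
  have arcs: "parcs G = (SIGMA u:pverts G. {v. (u, v) \<in> parcs G})"
    using in_arcsD1 by auto
  have "card (parcs G) = card (SIGMA u:pverts G. {v. (u, v) \<in> parcs G})"
    by (rule arg_cong[OF arcs])
  also have "\<dots> = (\<Sum>u\<in>pverts G. degree_of G u)"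
    using pair_finite_verts finite_subset[OF pair_graph_nbrs_subset[OF G]]
    by (subst card_SigmaI) (auto simp: degree_of_conv)
  finally have "(\<Sum>u\<in>pverts G. degree_of G u) = card (parcs G)" ..
  also have "\<dots> = (\<Sum>s\<in>?E. card {a \<in> parcs G. ?e a = s})"
  proof -
    have "parcs G = (\<Union>s\<in>?E. {a \<in> parcs G. ?e a = s})" unfolding E by auto
    then have "card (parcs G) = card (\<Union>s\<in>?E. {a \<in> parcs G. ?e a = s})" by simp
    also have "\<dots> = (\<Sum>s\<in>?E. card {a \<in> parcs G. ?e a = s})"
      by (rule card_UN_disjoint) (use finE pair_finite_arcs in auto)
    finally show ?thesis .
  qed
  also have "\<dots> = (\<Sum>s\<in>?E. 2)"
  proof (rule sum.cong)
    fix s assume "s \<in> ?E"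
    then obtain u v where s: "s = {u, v}" "(u, v) \<in> parcs G" by blast
    then have "u \<noteq> v" "(v, u) \<in> parcs G" using no_loops' arcs_symmetric by auto
    with s have "{a \<in> parcs G. ?e a = s} = {(u, v), (v, u)}"
      by (auto simp: doubleton_eq_iff)
    with \<open>u \<noteq> v\<close> show "card {a \<in> parcs G. ?e a = s} = 2" by simp
  qed simp
  finally show ?thesis by (simp add: graph_size_def)
qed

section \<open>Neighbours in the complement\<close>

definition conbrs :: "'a pair_pre_digraph \<Rightarrow> 'a \<Rightarrow> 'a set" where
  "conbrs G u = {v \<in> pverts G. v \<noteq> u \<and> (u, v) \<notin> parcs G}"

text \<open>For a simple graph this says that the complement is a perfect matching on
  \<open>T\<close> plus isolated vertices. With \<open>r + 1\<close> vertices and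
  \<open>card T = m\<close> it describes the extremal graph up to isomorphism, over any vertex
  type.\<close>

definition matching_complement :: "'a pair_pre_digraph \<Rightarrow> 'a set \<Rightarrow> bool" where
  "matching_complement G T \<longleftrightarrow> T \<subseteq> pverts G \<and>
     (\<forall>u\<in>pverts G. card (conbrs G u) = (if u \<in> T then 1 else 0))"

lemma conbrs_sym:
  assumes "pair_graph G" "u \<in> pverts G" "v \<in> conbrs G u"
  shows "u \<in> conbrs G v"
proof -
  interpret pair_graph G by fact
  show ?thesis using assms(2,3) arcs_symmetric by (auto simp: conbrs_def)
qed

lemma finite_conbrs: "pair_graph G \<Longrightarrow> finite (conbrs G u)"
  by (simp add: conbrs_def pair_graph_def pair_digraph_def pair_fin_digraph.pair_finite_verts)

lemma pverts_nbrs_conbrs: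
  assumes G: "pair_graph G" and u: "u \<in> pverts G"
  shows "pverts G = insert u ({v. (u, v) \<in> parcs G} \<union> conbrs G u)"
    and "finite {v. (u, v) \<in> parcs G}"
    and "u \<notin> {v. (u, v) \<in> parcs G} \<union> conbrs G u"
    and "{v. (u, v) \<in> parcs G} \<inter> conbrs G u = {}"
proof -
  interpret pair_graph G by fact
  show "pverts G = insert u ({v. (u, v) \<in> parcs G} \<union> conbrs G u)"
    using u pair_graph_nbrs_subset[OF G] by (auto simp: conbrs_def)
  show "finite {v. (u, v) \<in> parcs G}"
    using finite_subset[OF pair_graph_nbrs_subset[OF G] pair_finite_verts] .
  show "u \<notin> {v. (u, v) \<in> parcs G} \<union> conbrs G u"
    using no_loops' by (auto simp: conbrs_def)
  show "{v. (u, v) \<in> parcs G} \<inter> conbrs G u = {}"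
    by (auto simp: conbrs_def)
qed

lemma degree_add_codegree:
  assumes G: "pair_graph G" and u: "u \<in> pverts G"
  shows "Suc (degree_of G u + card (conbrs G u)) = graph_order G"
proof -
  have "card (pverts G) = Suc (card {v. (u, v) \<in> parcs G} + card (conbrs G u))"
    by (subst pverts_nbrs_conbrs(1)[OF G u])
       (simp del: Un_iff
         add: pverts_nbrs_conbrs(2-4)[OF G u] finite_conbrs[OF G] card_Un_disjoint)
  then show ?thesis by (simp add: graph_order_def degree_of_conv)
qed

lemma nbr_sum_codegree:
  assumes G: "pair_graph G" and u: "u \<in> pverts G"
  shows "nbr_sum G x u = (\<Sum>v\<in>pverts G. x v) - x u - (\<Sum>v\<in>conbrs G u. x v)"
proof -
  have "(\<Sum>v\<in>pverts G. x v) = x u + (nbr_sum G x u + (\<Sum>v\<in>conbrs G u. x v))"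
    unfolding nbr_sum_def
    by (subst pverts_nbrs_conbrs(1)[OF G u])
       (simp del: Un_iff
         add: pverts_nbrs_conbrs(2-4)[OF G u] finite_conbrs[OF G] sum.union_disjoint)
  then show ?thesis by simp
qed

section \<open>The two-valued test vector\<close>

lemma nbr_sum_two_valued:
  fixes \<rho> :: real
  assumes G: "pair_graph G" and n: "graph_order G = r + 1"
    and T: "T \<subseteq> pverts G" "card T = m"
    and zero: "\<And>u. u \<in> pverts G \<Longrightarrow> u \<notin> T \<Longrightarrow> conbrs G u = {}"
    and \<rho>: "(real r - \<rho>) * (\<rho> + 2) = real m"
    and u: "u \<in> pverts G"
  defines "x \<equiv> \<lambda>u. if u \<in> T then \<rho> + 1 else \<rho> + 2"
  shows "nbr_sum G x u
    = \<rho> * x u + (if u \<in> T then (\<rho> + 1) * (1 - real (card (conbrs G u))) else 0)"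
proof -
  interpret pair_graph G by fact
  have "(\<Sum>v\<in>pverts G. x v) = (\<Sum>v\<in>pverts G. (\<rho> + 2) - (if v \<in> T then 1 else 0))"
    by (intro sum.cong) (auto simp: x_def)
  also have "\<dots> = (real r + 1) * (\<rho> + 2) - real m"
    using n T pair_finite_verts
    by (simp add: sum_subtractf sum.inter_restrict[symmetric] Int_absorb1 graph_order_def)
  finally have total: "(\<Sum>v\<in>pverts G. x v) = (real r + 1) * (\<rho> + 2) - real m" .
  \<comment> \<open>Being non-adjacent is symmetric, so \<open>v\<close> has \<open>u\<close> as a
    neighbour in the complement and cannot lie outside \<open>T\<close>; hence \<open>x\<close> is
    constantly \<open>\<rho> + 1\<close> on \<open>conbrs G u\<close>.\<close>
  have "v \<in> T" if "v \<in> conbrs G u" for v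
    using that zero[of v] conbrs_sym[OF G u that] by (auto simp: conbrs_def)
  then have "(\<Sum>v\<in>conbrs G u. x v) = (\<Sum>v\<in>conbrs G u. \<rho> + 1)"
    by (intro sum.cong) (auto simp: x_def)
  also have "\<dots> = real (card (conbrs G u)) * (\<rho> + 1)" by simp
  finally have "nbr_sum G x u = (real r + 1) * (\<rho> + 2) - real m - x u - real (card (conbrs G u)) * (\<rho> + 1)"
    using total by (simp add: nbr_sum_codegree[OF G u])
  \<comment> \<open>Writing \<open>m\<close> as \<open>(r - \<rho>) * (\<rho> + 2)\<close> turns
    \<open>(r + 1) * (\<rho> + 2) - m\<close> into \<open>(\<rho> + 1) * (\<rho> + 2)\<close>.
    Outside \<open>T\<close> exactly \<open>\<rho> * x u\<close> remains; on \<open>T\<close> the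
    error measures how far the codegree is from one.\<close>
  then show ?thesis
    using zero[OF u] \<rho>[symmetric] by (auto simp: x_def algebra_simps)
qed

lemma matching_complement_conbrs_empty:
  assumes "pair_graph G" "matching_complement G T" "u \<in> pverts G" "u \<notin> T"
  shows "conbrs G u = {}"
  using assms finite_conbrs[of G u] by (auto simp: matching_complement_def)

text \<open>All codegrees on \<open>T\<close> are one, so the error term vanishes and the test
  vector is a positive eigenvector.\<close>

lemma lambda1_matching_complement:
  fixes \<rho> :: real
  assumes G: "pair_graph G" and n: "graph_order G = r + 1"
    and T: "matching_complement G T" "card T = m"
    and \<rho>: "(real r - \<rho>) * (\<rho> + 2) = real m" "\<rho> > 0"
  shows "lambda1 G = \<rho>"
proof (rule lambda1_eqI_positive_eigenvector[OF G, where x = "\<lambda>u. if u \<in> T then \<rho> + 1 else \<rho> + 2"])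
  show "pverts G \<noteq> {}" using n by (auto simp: graph_order_def)
  show "(if u \<in> T then \<rho> + 1 else \<rho> + 2) > 0" for u using \<rho>(2) by simp
  show "nbr_sum G (\<lambda>u. if u \<in> T then \<rho> + 1 else \<rho> + 2) u
      = \<rho> * (if u \<in> T then \<rho> + 1 else \<rho> + 2)" if u: "u \<in> pverts G" for u
    using nbr_sum_two_valued[OF G n _ T(2) matching_complement_conbrs_empty[OF G T(1)] \<rho>(1) u] T(1) u
    by (simp add: matching_complement_def)
qed

text \<open>The errors of the test vector add up to \<open>(\<rho> + 1)\<^sup>2\<close> times the
  sum of \<open>1 - card (conbrs G u)\<close> over \<open>T\<close>. This is nonnegative because
  \<open>T\<close> has \<open>m\<close> elements and the total codegree is at most
  \<open>m\<close>.\<close>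

lemma lambda1_lower_bound:
  fixes \<rho> :: real
  assumes G: "pair_graph G" and n: "graph_order G = r + 1"
    and size: "(\<Sum>u\<in>pverts G. card (conbrs G u)) \<le> m" and m: "m \<le> r + 1"
    and \<rho>: "(real r - \<rho>) * (\<rho> + 2) = real m" "\<rho> > 0"
  shows "\<rho> \<le> lambda1 G"
    and "lambda1 G = \<rho> \<Longrightarrow> \<exists>T. matching_complement G T \<and> card T = m"
proof -
  interpret pair_graph G by fact
  let ?V = "pverts G" and ?c = "\<lambda>u. card (conbrs G u)"
  let ?S = "{u \<in> ?V. conbrs G u \<noteq> {}}"
  have "card ?S = (\<Sum>u\<in>?S. 1)" by simp
  also have "\<dots> \<le> (\<Sum>u\<in>?S. ?c u)"
    by (intro sum_mono) (auto simp: Suc_le_eq card_gt_0_iff finite_conbrs[OF G])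
  also have "\<dots> \<le> (\<Sum>u\<in>?V. ?c u)"
    by (intro sum_mono2) (auto simp: pair_finite_verts)
  finally have "card ?S \<le> m" using size by simp
  \<comment> \<open>The vertices with a non-neighbour may be fewer than \<open>m\<close>; they are
    padded to exactly \<open>m\<close>, which is possible since \<open>m \<le> r + 1\<close> and
    there are \<open>r + 1\<close> vertices.\<close>
  then obtain T where T: "?S \<subseteq> T" "T \<subseteq> ?V" "card T = m"
    using exists_subset_between[of ?S m ?V] m n pair_finite_verts
    by (auto simp: graph_order_def)
  have zero: "conbrs G u = {}" if "u \<in> ?V" "u \<notin> T" for u using that T by blast
  define x where "x u = (if u \<in> T then \<rho> + 1 else \<rho> + 2)" for u
  have nbr: "nbr_sum G x u = \<rho> * x u + (if u \<in> T then (\<rho> + 1) * (1 - real (?c u)) else 0)"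
    if "u \<in> ?V" for u
    unfolding x_def by (rule nbr_sum_two_valued[OF G n T(2,3) zero \<rho>(1) that])
  have "(\<Sum>u\<in>T. ?c u) \<le> m"
    using size sum_mono2[OF pair_finite_verts T(2), of ?c] by simp
  then have "real (\<Sum>u\<in>T. ?c u) \<le> real m" by (rule of_nat_mono)
  then have excess: "(\<Sum>u\<in>T. 1 - real (?c u)) \<ge> 0"
    using T(3) by (simp add: sum_subtractf)
  have "(\<Sum>u\<in>?V. x u * nbr_sum G x u)
      = (\<Sum>u\<in>?V. \<rho> * (x u)\<^sup>2 + (if u \<in> T then (\<rho> + 1)\<^sup>2 * (1 - real (?c u)) else 0))"
    by (intro sum.cong refl) (simp add: nbr x_def power2_eq_square algebra_simps)
  also have "\<dots> = \<rho> * (\<Sum>u\<in>?V. (x u)\<^sup>2) + (\<rho> + 1)\<^sup>2 * (\<Sum>u\<in>T. 1 - real (?c u))"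
    using T(2) pair_finite_verts
    by (simp add: sum.distrib sum_distrib_left sum.inter_restrict[symmetric] Int_absorb1)
  finally have Q: "(\<Sum>u\<in>?V. x u * nbr_sum G x u)
      = \<rho> * (\<Sum>u\<in>?V. (x u)\<^sup>2) + (\<rho> + 1)\<^sup>2 * (\<Sum>u\<in>T. 1 - real (?c u))" .
  have ne: "?V \<noteq> {}" using n by (auto simp: graph_order_def)
  have N: "(\<Sum>u\<in>?V. (x u)\<^sup>2) > 0"
    using \<rho>(2) ne pair_finite_verts by (intro sum_pos) (auto simp: x_def)
  have le: "\<rho> * (\<Sum>u\<in>?V. (x u)\<^sup>2) \<le> (\<Sum>u\<in>?V. x u * nbr_sum G x u)"
    using Q excess by simp
  also have "\<dots> \<le> lambda1 G * (\<Sum>u\<in>?V. (x u)\<^sup>2)"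
    by (rule lambda1_rayleigh[OF G ne])
  finally show "\<rho> \<le> lambda1 G" using N by simp
  assume eq: "lambda1 G = \<rho>"
  have "(\<Sum>u\<in>?V. x u * nbr_sum G x u) = lambda1 G * (\<Sum>u\<in>?V. (x u)\<^sup>2)"
    using le lambda1_rayleigh[OF G ne, of x] eq by simp
  from lambda1_rayleigh_eq[OF G this]
  \<comment> \<open>The test vector is now an eigenvector for \<open>\<rho>\<close>, so the error
    vanishes at each vertex and not only in total. This rules out padding vertices, whose codegree
    would be zero.\<close>
  have excess0: "(if u \<in> T then (\<rho> + 1) * (1 - real (?c u)) else 0) = 0" if "u \<in> ?V" for u
    using nbr[OF that] that eq by simp
  have "?c u = 1" if "u \<in> T" for u
    using excess0[of u] that T(2) \<rho>(2) by auto
  then have "matching_complement G T"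
    using T zero by (auto simp: matching_complement_def)
  with T(3) show "\<exists>T. matching_complement G T \<and> card T = m" by blast
qed

text \<open>The Rayleigh quotient of the constant vector is the average degree.\<close>

lemma lambda1_ge_average_degree:
  assumes G: "pair_graph G" and ne: "pverts G \<noteq> {}"
  shows "2 * real (graph_size G) \<le> lambda1 G * real (graph_order G)"
proof -
  have "(\<Sum>u\<in>pverts G. nbr_sum G (\<lambda>_. 1) u) = real (\<Sum>u\<in>pverts G. degree_of G u)"
    by (simp add: nbr_sum_one)
  then show ?thesis
    using lambda1_rayleigh[OF G ne, of "\<lambda>_. 1"] by (simp add: handshake[OF G] graph_order_def)
qed

section \<open>Isomorphism\<close>

text \<open>Reduces \<open>digraph_iso\<close>, which also carries an arc map and new head and tail
  maps, to a bijection preserving adjacency: arcs are mapped by \<open>map_prod f f\<close>, and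
  head and tail stay the projections.\<close>

lemma digraph_iso_with_projI:
  assumes G: "pair_graph G" and H: "pair_graph H"
    and bij: "bij_betw f (pverts G) (pverts H)"
    and arcs: "\<And>u v. u \<in> pverts G \<Longrightarrow> v \<in> pverts G \<Longrightarrow> (u, v) \<in> parcs G \<longleftrightarrow> (f u, f v) \<in> parcs H"
  shows "digraph_iso (with_proj G) (with_proj H)"
proof -
  interpret G: pair_graph G by fact
  interpret H: pair_graph H by fact
  define h where "h = \<lparr>iso_verts = f, iso_arcs = map_prod f f, iso_head = snd, iso_tail = fst\<rparr>"
  have inj: "inj_on f (pverts G)" and surj: "f ` pverts G = pverts H"
    using bij by (auto simp: bij_betw_def)
  have img: "map_prod f f ` parcs G = parcs H"
  proof
    have "(f u, f v) \<in> parcs H" if "(u, v) \<in> parcs G" for u v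
      using arcs[OF G.in_arcsD1[OF that] G.in_arcsD2[OF that]] that by simp
    then show "map_prod f f ` parcs G \<subseteq> parcs H" by auto
    show "parcs H \<subseteq> map_prod f f ` parcs G"
    proof
      fix e assume e: "e \<in> parcs H"
      obtain a b where ab: "e = (a, b)" by force
      with e H.in_arcsD1 H.in_arcsD2 surj obtain u v
        where uv: "u \<in> pverts G" "v \<in> pverts G" and "a = f u" "b = f v" by blast
      with arcs[OF uv] e ab have "(u, v) \<in> parcs G" "e = map_prod f f (u, v)" by auto
      then show "e \<in> map_prod f f ` parcs G" by blast
    qed
  qed
  have "inj_on (map_prod f f) (parcs G)"
    by (rule inj_on_subset[OF map_prod_inj_on[OF inj inj]])
       (use G.in_arcsD1 G.in_arcsD2 in auto)
  moreover have "wf_digraph (with_proj G)" by unfold_locales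
  ultimately have "pre_digraph.digraph_isomorphism (with_proj G) h"
    using inj by (simp add: pre_digraph.digraph_isomorphism_def h_def)
  moreover have "with_proj H = app_iso h (with_proj G)"
    using img surj by (simp add: app_iso_def h_def with_proj_def)
  ultimately show ?thesis unfolding digraph_iso_def by blast
qed

lemma digraph_iso_with_projE:
  assumes G: "pair_graph G" and iso: "digraph_iso (with_proj G) (with_proj H)"
  obtains f where "bij_betw f (pverts G) (pverts H)"
    "\<And>u v. u \<in> pverts G \<Longrightarrow> v \<in> pverts G \<Longrightarrow> (u, v) \<in> parcs G \<longleftrightarrow> (f u, f v) \<in> parcs H"
proof -
  interpret G: pair_graph G by fact
  obtain h where h: "pre_digraph.digraph_isomorphism (with_proj G) h"
    and app: "with_proj H = app_iso h (with_proj G)"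
    using iso by (auto simp: digraph_iso_def)
  let ?f = "iso_verts h"
  have inj: "inj_on ?f (pverts G)" using h by (simp add: pre_digraph.digraph_isomorphism_def)
  have HV: "pverts H = ?f ` pverts G" and HA: "parcs H = iso_arcs h ` parcs G"
    and ht: "fst = iso_tail h" "snd = iso_head h"
    using app by (simp_all add: app_iso_def with_proj_def)
  \<comment> \<open>Since the head and tail maps of \<open>h\<close> must be the projections of
    \<open>H\<close>, the vertex map determines the arc map.\<close>
  have arc: "iso_arcs h (u, v) = (?f u, ?f v)" if "(u, v) \<in> parcs G" for u v
  proof -
    have "fst (iso_arcs h (u, v)) = ?f u" "snd (iso_arcs h (u, v)) = ?f v"
      using h that unfolding ht by (auto simp: pre_digraph.digraph_isomorphism_def)
    then show ?thesis by (simp add: prod_eq_iff)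
  qed
  have "(u, v) \<in> parcs G \<longleftrightarrow> (?f u, ?f v) \<in> parcs H" if uv: "u \<in> pverts G" "v \<in> pverts G" for u v
  proof
    assume "(u, v) \<in> parcs G"
    then show "(?f u, ?f v) \<in> parcs H" using arc HA by (metis image_eqI)
  next
    assume "(?f u, ?f v) \<in> parcs H"
    then obtain a b where ab: "(a, b) \<in> parcs G" "iso_arcs h (a, b) = (?f u, ?f v)"
      using HA by auto
    with arc have "?f a = ?f u" "?f b = ?f v" by auto
    with inj uv ab(1) G.in_arcsD1 G.in_arcsD2 show "(u, v) \<in> parcs G"
      by (metis inj_on_eq_iff)
  qed
  moreover have "bij_betw ?f (pverts G) (pverts H)" using inj HV by (simp add: bij_betw_def)
  ultimately show ?thesis by (intro that) auto
qed

text \<open>Pulls the matched set back along the isomorphism, so that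
  \<open>lambda1_matching_complement\<close> applies to every graph isomorphic to the extremal
  one.\<close>

lemma matching_complement_iso:
  assumes G: "pair_graph G" and T: "matching_complement H T"
    and iso: "digraph_iso (with_proj G) (with_proj H)"
  obtains T' where "matching_complement G T'" "card T' = card T" "graph_order G = graph_order H"
proof -
  obtain f where bij: "bij_betw f (pverts G) (pverts H)"
    and arcs: "\<And>u v. u \<in> pverts G \<Longrightarrow> v \<in> pverts G \<Longrightarrow> (u, v) \<in> parcs G \<longleftrightarrow> (f u, f v) \<in> parcs H"
    using digraph_iso_with_projE[OF G iso] by blast
  have inj: "inj_on f (pverts G)" and surj: "f ` pverts G = pverts H"
    using bij by (auto simp: bij_betw_def)
  have conbrs: "conbrs H (f u) = f ` conbrs G u" if "u \<in> pverts G" for u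
    using that arcs inj unfolding conbrs_def surj[symmetric] by (auto simp: inj_on_eq_iff)
  have card: "card (conbrs H (f u)) = card (conbrs G u)" if "u \<in> pverts G" for u
    unfolding conbrs[OF that] by (intro card_image inj_on_subset[OF inj]) (auto simp: conbrs_def)
  define T' where "T' = {u \<in> pverts G. f u \<in> T}"
  have "T = f ` T'" using T surj by (auto simp: T'_def matching_complement_def)
  moreover have "inj_on f T'" by (rule inj_on_subset[OF inj]) (auto simp: T'_def)
  ultimately have "card T' = card T" by (simp add: card_image)
  moreover have "matching_complement G T'"
    unfolding matching_complement_def
  proof (intro conjI ballI)
    fix u assume u: "u \<in> pverts G"
    then have "f u \<in> pverts H" using surj by blast
    then have "card (conbrs H (f u)) = (if f u \<in> T then 1 else 0)"
      using T by (simp add: matching_complement_def)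
    then show "card (conbrs G u) = (if u \<in> T' then 1 else 0)"
      using card[OF u] u by (simp add: T'_def)
  qed (auto simp: T'_def)
  moreover have "graph_order G = graph_order H"
    using bij_betw_same_card[OF bij] by (simp add: graph_order_def)
  ultimately show ?thesis using that by blast
qed

text \<open>Perfect matchings of equal size are isomorphic. One pair \<open>{a, p a}\<close> is
  removed from \<open>T\<close>, one pair \<open>{b, q b}\<close> from \<open>T'\<close>, and the
  bijection obtained by induction is extended by sending \<open>a\<close> to \<open>b\<close> and
  \<open>p a\<close> to \<open>q b\<close>.\<close>

lemma fixpoint_free_involutions_conjugate:
  assumes "finite T" "finite T'" "card T = card T'"
    and "\<And>u. u \<in> T \<Longrightarrow> p u \<in> T \<and> p u \<noteq> u \<and> p (p u) = u"
    and "\<And>u. u \<in> T' \<Longrightarrow> q u \<in> T' \<and> q u \<noteq> u \<and> q (q u) = u"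
  shows "\<exists>f. bij_betw f T T' \<and> (\<forall>u\<in>T. f (p u) = q (f u))"
  using assms
proof (induction "card T" arbitrary: T T' rule: less_induct)
  case less
  show ?case
  proof (cases "T = {}")
    case True
    then show ?thesis using less.prems by (auto simp: bij_betw_def)
  next
    case False
    then obtain a where a: "a \<in> T" by blast
    have "T' \<noteq> {}" using False less.prems by auto
    then obtain b where b: "b \<in> T'" by blast
    let ?T = "T - {a, p a}" and ?T' = "T' - {b, q b}"
    note p = less.prems(4) and q = less.prems(5)
    have cT: "card ?T = card T - 2" and cT': "card ?T' = card T' - 2"
      using a b p[OF a] q[OF b] less.prems(1,2)
      by (auto simp: card_Diff_subset card_insert_if numeral_2_eq_2)
    have "card T > 0" using a less.prems(1) by (auto simp: card_gt_0_iff)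
    have pT: "p u \<in> ?T \<and> p u \<noteq> u \<and> p (p u) = u" if "u \<in> ?T" for u
      using that p[of u] p[OF a] by auto
    have qT: "q u \<in> ?T' \<and> q u \<noteq> u \<and> q (q u) = u" if "u \<in> ?T'" for u
      using that q[of u] q[OF b] by auto
    have less_card: "card ?T < card T" and eq_card: "card ?T = card ?T'"
      using cT cT' \<open>card T > 0\<close> less.prems(3) by linarith+
    have "finite ?T" "finite ?T'" using less.prems(1,2) by simp_all
    from less.hyps[OF less_card this eq_card pT qT]
    obtain f where f: "bij_betw f ?T ?T'" "\<And>u. u \<in> ?T \<Longrightarrow> f (p u) = q (f u)"
      by blast
    define g where "g = f(a := b, p a := q b)"
    have "bij_betw g ?T ?T'"
      using f(1) by (rule bij_betw_cong[THEN iffD1, rotated]) (auto simp: g_def)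
    moreover have "bij_betw g {a, p a} {b, q b}"
      using p[OF a] q[OF b] by (auto simp: bij_betw_def g_def)
    ultimately have "bij_betw g (?T \<union> {a, p a}) (?T' \<union> {b, q b})"
      by (rule bij_betw_combine) auto
    moreover have "?T \<union> {a, p a} = T" "?T' \<union> {b, q b} = T'"
      using a b p[OF a] q[OF b] by auto
    ultimately have "bij_betw g T T'" by simp
    moreover have "g (p u) = q (g u)" if u: "u \<in> T" for u
    proof (cases "u \<in> {a, p a}")
      case True
      then show ?thesis using p[OF a] q[OF b] by (auto simp: g_def)
    next
      case False
      then have "p u \<notin> {a, p a}" using p[OF u] p[OF a] by auto
      then show ?thesis using False f(2)[of u] u by (simp add: g_def)
    qed
    ultimately show ?thesis by blast
  qed
qed

text \<open>Each vertex of \<open>T\<close> has a unique non-neighbour \<open>p u\<close>; symmetry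
  places it in \<open>T\<close> and makes \<open>p\<close> an involution that determines all
  arcs.\<close>

lemma matching_complement_involution:
  assumes G: "pair_graph G" and T: "matching_complement G T"
  obtains p where "\<And>u. u \<in> T \<Longrightarrow> p u \<in> T \<and> p u \<noteq> u \<and> p (p u) = u"
    "\<And>u v. u \<in> pverts G \<Longrightarrow> v \<in> pverts G \<Longrightarrow>
       (u, v) \<in> parcs G \<longleftrightarrow> u \<noteq> v \<and> \<not> (u \<in> T \<and> v = p u)"
proof -
  interpret G: pair_graph G by fact
  have TV: "T \<subseteq> pverts G" using T by (simp add: matching_complement_def)
  define p where "p u = the_elem (conbrs G u)" for u
  have p: "conbrs G u = {p u}" if "u \<in> T" for u
  proof -
    have "card (conbrs G u) = 1" using that T by (auto simp: matching_complement_def)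
    then show ?thesis unfolding p_def by (metis card_1_singletonE the_elem_eq)
  qed
  have empty: "conbrs G u = {}" if "u \<in> pverts G" "u \<notin> T" for u
    by (rule matching_complement_conbrs_empty[OF G T that])
  have "p u \<in> T \<and> p u \<noteq> u \<and> p (p u) = u" if u: "u \<in> T" for u
  proof -
    have pu: "p u \<in> conbrs G u" using p[OF u] by simp
    then have V: "p u \<in> pverts G" "p u \<noteq> u" by (auto simp: conbrs_def)
    have "u \<in> conbrs G (p u)" using conbrs_sym[OF G _ pu] u TV by auto
    then show ?thesis using empty[OF V(1)] p[of "p u"] V(2) by (cases "p u \<in> T") auto
  qed
  moreover have "(u, v) \<in> parcs G \<longleftrightarrow> u \<noteq> v \<and> \<not> (u \<in> T \<and> v = p u)"
    if uv: "u \<in> pverts G" "v \<in> pverts G" for u v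
  proof -
    have "(u, v) \<in> parcs G \<longleftrightarrow> u \<noteq> v \<and> v \<notin> conbrs G u"
      using uv G.no_loops' by (auto simp: conbrs_def)
    then show ?thesis using p[of u] empty[OF uv(1)] by (cases "u \<in> T") auto
  qed
  ultimately show ?thesis by (rule that)
qed

text \<open>On the matched sets the bijection conjugates the two involutions. Vertices outside are
  adjacent to everything, so any bijection serves there.\<close>

lemma matching_complement_unique:
  assumes G: "pair_graph G" and H: "pair_graph H"
    and T: "matching_complement G T" and T': "matching_complement H T'"
    and order: "graph_order G = graph_order H" and card: "card T = card T'"
  shows "digraph_iso (with_proj G) (with_proj H)"
proof -
  interpret G: pair_graph G by fact
  interpret H: pair_graph H by fact
  obtain p where p: "\<And>u. u \<in> T \<Longrightarrow> p u \<in> T \<and> p u \<noteq> u \<and> p (p u) = u"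
    and Garcs: "\<And>u v. u \<in> pverts G \<Longrightarrow> v \<in> pverts G \<Longrightarrow>
       (u, v) \<in> parcs G \<longleftrightarrow> u \<noteq> v \<and> \<not> (u \<in> T \<and> v = p u)"
    using matching_complement_involution[OF G T] by blast
  obtain q where q: "\<And>u. u \<in> T' \<Longrightarrow> q u \<in> T' \<and> q u \<noteq> u \<and> q (q u) = u"
    and Harcs: "\<And>u v. u \<in> pverts H \<Longrightarrow> v \<in> pverts H \<Longrightarrow>
       (u, v) \<in> parcs H \<longleftrightarrow> u \<noteq> v \<and> \<not> (u \<in> T' \<and> v = q u)"
    using matching_complement_involution[OF H T'] by blast
  have TV: "T \<subseteq> pverts G" "T' \<subseteq> pverts H"
    using T T' by (simp_all add: matching_complement_def)
  then have fin: "finite T" "finite T'"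
    using G.pair_finite_verts H.pair_finite_verts finite_subset by blast+
  obtain f where f: "bij_betw f T T'" "\<And>u. u \<in> T \<Longrightarrow> f (p u) = q (f u)"
    using fixpoint_free_involutions_conjugate[OF fin card p q] by blast
  have "card (pverts G - T) = card (pverts H - T')"
    using TV fin card order by (simp add: card_Diff_subset graph_order_def)
  then obtain g where g: "bij_betw g (pverts G - T) (pverts H - T')"
    using finite_same_card_bij[of "pverts G - T" "pverts H - T'"]
      G.pair_finite_verts H.pair_finite_verts by auto
  define h where "h u = (if u \<in> T then f u else g u)" for u
  have "bij_betw h T T'"
    using f(1) by (rule bij_betw_cong[THEN iffD1, rotated]) (auto simp: h_def)
  moreover have "bij_betw h (pverts G - T) (pverts H - T')"
    using g by (rule bij_betw_cong[THEN iffD1, rotated]) (auto simp: h_def)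
  ultimately have "bij_betw h (T \<union> (pverts G - T)) (T' \<union> (pverts H - T'))"
    by (rule bij_betw_combine) auto
  moreover have "T \<union> (pverts G - T) = pverts G" "T' \<union> (pverts H - T') = pverts H"
    using TV by auto
  ultimately have h: "bij_betw h (pverts G) (pverts H)" by simp
  have hV: "h u \<in> pverts H" if "u \<in> pverts G" for u using h that by (auto simp: bij_betw_def)
  have hT: "h u \<in> T' \<longleftrightarrow> u \<in> T" if "u \<in> pverts G" for u
    using f(1) g that by (auto simp: h_def bij_betw_def)
  have heq: "h u = h v \<longleftrightarrow> u = v" if "u \<in> pverts G" "v \<in> pverts G" for u v
    using h that by (auto simp: bij_betw_def inj_on_eq_iff)
  show ?thesis
  proof (rule digraph_iso_with_projI[OF G H h])
    fix u v assume uv: "u \<in> pverts G" "v \<in> pverts G"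
    have "h v = q (h u) \<longleftrightarrow> v = p u" if "u \<in> T"
    proof -
      have "q (h u) = h (p u)" using that f(2) p by (simp add: h_def)
      then show ?thesis using heq[OF uv(2), of "p u"] p[OF that] TV by auto
    qed
    then show "(u, v) \<in> parcs G \<longleftrightarrow> (h u, h v) \<in> parcs H"
      using Garcs[OF uv] Harcs[OF hV[OF uv(1)] hV[OF uv(2)]] hT[OF uv(1)] heq[OF uv] by auto
  qed
qed

section \<open>The extremal problem\<close>

lemma connected_if_universal_vertex:
  assumes G: "pair_graph G" and w: "w \<in> pverts G" "conbrs G w = {}"
  shows "Digraph_Component.connected (with_proj G)"
proof -
  interpret G: pair_graph G by fact
  let ?R = "(arcs_ends (with_proj G))\<^sup>s" and ?C = "rtrancl_on (pverts G) ((arcs_ends (with_proj G))\<^sup>s)"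
  have w_arc: "(w, v) \<in> parcs G" if "v \<in> pverts G" "v \<noteq> w" for v
    using w that by (auto simp: conbrs_def)
  have to: "(w, v) \<in> ?C" if "v \<in> pverts G" for v
  proof (cases "v = w")
    case False
    then have "(w, v) \<in> ?R" using w_arc[OF that] by (simp add: symcl_def)
    then show ?thesis using that w(1) by (meson rtrancl_on.simps)
  qed (use w(1) in auto)
  have from_v: "(v, w) \<in> ?C" if "v \<in> pverts G" for v
  proof (cases "v = w")
    case False
    then have "(v, w) \<in> ?R"
      using G.arcs_symmetric[OF w_arc[OF that]] by (simp add: symcl_def)
    then show ?thesis using that w(1) by (meson rtrancl_on.simps)
  qed (use w(1) in auto)
  show ?thesis
    unfolding connected_conv
  proof (intro conjI ballI)
    show "verts (with_proj G) \<noteq> {}" using w(1) by auto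
    fix u v assume "u \<in> verts (with_proj G)" "v \<in> verts (with_proj G)"
    then show "(u, v) \<in> rtrancl_on (verts (with_proj G)) ?R"
      using rtrancl_on_trans[OF from_v to] by simp
  qed
qed

text \<open>Turns the condition on the number of edges into a bound on the total codegree when there
  are \<open>r + 1\<close> vertices.\<close>

lemma sum_degree_add_sum_codegree:
  assumes G: "pair_graph G" and n: "graph_order G = r + 1"
  shows "2 * graph_size G + (\<Sum>u\<in>pverts G. card (conbrs G u)) = r * (r + 1)"
proof -
  have "(\<Sum>u\<in>pverts G. degree_of G u + card (conbrs G u)) = (\<Sum>u\<in>pverts G. r)"
    using degree_add_codegree[OF G] n by (intro sum.cong) auto
  then show ?thesis
    using n by (simp add: sum.distrib handshake[OF G] graph_order_def)
qed

lemma matching_complement_in_H_class: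
  assumes G: "pair_graph G" and n: "graph_order G = r + 1"
    and T: "matching_complement G T" "card T = m" and m: "2 \<le> m" "m \<le> r"
  shows "G \<in> H_class r m"
proof -
  interpret G: pair_graph G by fact
  have TV: "T \<subseteq> pverts G" using T by (simp add: matching_complement_def)
  have finT: "finite T" using TV G.pair_finite_verts finite_subset by blast
  have deg: "degree_of G u = (if u \<in> T then r - 1 else r)" if "u \<in> pverts G" for u
    using degree_add_codegree[OF G that] n T that by (auto simp: matching_complement_def)
  \<comment> \<open>Here \<open>m \<le> r\<close> enters: a vertex \<open>w\<close> outside
    \<open>T\<close> has degree \<open>r\<close> and is adjacent to all others. It yields the
    maximum degree, connectedness and, compared with a vertex of \<open>T\<close> of degree
    \<open>r - 1\<close>, irregularity.\<close>
  have "card T < card (pverts G)" using T m n by (simp add: graph_order_def)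
  then obtain w where w: "w \<in> pverts G" "w \<notin> T"
    using card_mono[OF finT, of "pverts G"] by (meson not_less subsetI)
  obtain t where t: "t \<in> T" using T(2) m by fastforce
  have "max_degree G = r"
    unfolding max_degree_def
    by (rule Max_eqI) (use deg w G.pair_finite_verts in \<open>auto simp: image_iff intro!: bexI[of _ w]\<close>)
  moreover have "degree_of G t \<noteq> degree_of G w"
    using deg[of w] deg[of t] w t TV m by auto
  then have "\<not> regular_graph G"
    using w(1) t TV unfolding regular_graph_def by (metis subsetD)
  moreover have "Digraph_Component.connected (with_proj G)"
    using connected_if_universal_vertex[OF G w(1)] matching_complement_conbrs_empty[OF G T(1) w] by simp
  moreover have "(\<Sum>u\<in>pverts G. card (conbrs G u)) = m"
  proof -
    have "(\<Sum>u\<in>pverts G. card (conbrs G u)) = (\<Sum>u\<in>pverts G. if u \<in> T then 1 else 0)"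
      using T(1) by (intro sum.cong) (auto simp: matching_complement_def)
    then show ?thesis
      using T(2) TV G.pair_finite_verts by (simp add: sum.inter_restrict[symmetric] Int_absorb1)
  qed
  then have "2 * graph_size G + m = r * (r + 1)"
    using sum_degree_add_sum_codegree[OF G n] by simp
  then have "int (2 * graph_size G + m) = int (r * (r + 1))" by simp
  then have "2 * int (graph_size G) \<ge> int r * int (graph_order G) - int m"
    by (simp add: n algebra_simps)
  moreover have "graph_order G mod 2 \<noteq> r mod 2" unfolding n by presburger
  ultimately show ?thesis using G by (simp add: H_class_def)
qed

lemma H_class_lambda1_bound:
  fixes \<rho> :: real
  assumes H: "H \<in> H_class r m" and m: "m \<le> r + 1"
    and \<rho>: "(real r - \<rho>) * (\<rho> + 2) = real m" "\<rho> > 0" "\<rho> < real r"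
  shows "\<rho> \<le> lambda1 H"
    and "lambda1 H = \<rho> \<Longrightarrow> graph_order H = r + 1 \<and> (\<exists>T. matching_complement H T \<and> card T = m)"
proof -
  have G: "pair_graph H" and conn: "Digraph_Component.connected (with_proj H)"
    and par: "graph_order H mod 2 \<noteq> r mod 2" and max: "max_degree H = r"
    and size: "2 * int (graph_size H) \<ge> int r * int (graph_order H) - int m"
    using H by (auto simp: H_class_def)
  interpret G: pair_graph H by fact
  have ne: "pverts H \<noteq> {}" using conn by (auto simp: connected_conv)
  have "max_degree H \<in> degree_of H ` pverts H"
    unfolding max_degree_def using ne G.pair_finite_verts by (intro Max_in) auto
  then obtain u where u: "u \<in> pverts H" "degree_of H u = r" using max by auto
  \<comment> \<open>A vertex of degree \<open>r\<close> needs \<open>r\<close> neighbours besides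
    itself, and parity then excludes order \<open>r + 2\<close>.\<close>
  have "graph_order H \<ge> r + 1" using degree_add_codegree[OF G u(1)] u(2) by simp
  moreover have "graph_order H \<noteq> r + 2" using par by auto
  ultimately consider "graph_order H = r + 1" | "graph_order H \<ge> r + 3" by linarith
  then have "\<rho> \<le> lambda1 H \<and> (lambda1 H = \<rho> \<longrightarrow>
      graph_order H = r + 1 \<and> (\<exists>T. matching_complement H T \<and> card T = m))"
  proof cases
    case 1
    have "int (r * (r + 1)) \<le> int (2 * graph_size H + m)" using size 1 by (simp add: algebra_simps)
    then have "r * (r + 1) \<le> 2 * graph_size H + m" by (simp only: of_nat_le_iff)
    then have "(\<Sum>u\<in>pverts H. card (conbrs H u)) \<le> m"
      using sum_degree_add_sum_codegree[OF G 1] by linarith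
    from lambda1_lower_bound[OF G 1 this m \<rho>(1,2)] 1 show ?thesis by blast
  next
    case 2
    let ?n = "real (graph_order H)"
    have "real_of_int (int r * int (graph_order H) - int m) \<le> real_of_int (2 * int (graph_size H))"
      using size by (simp only: of_int_le_iff)
    then have "real r * ?n - real m \<le> lambda1 H * ?n"
      using lambda1_ge_average_degree[OF G ne] by simp
    \<comment> \<open>Subtracting \<open>\<rho> * ?n\<close> and replacing \<open>m\<close> by
      \<open>(r - \<rho>) * (\<rho> + 2)\<close> exposes the factor
      \<open>?n - (\<rho> + 2)\<close>, which is positive because \<open>\<rho> < r\<close> and
      \<open>?n \<ge> r + 3\<close>.\<close>
    then have "(real r - \<rho>) * (?n - (\<rho> + 2)) \<le> (lambda1 H - \<rho>) * ?n"
      using \<rho>(1) by (simp add: algebra_simps)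
    moreover have "(real r - \<rho>) * (?n - (\<rho> + 2)) > 0"
      using 2 \<rho>(3) by (intro mult_pos_pos) auto
    ultimately have "(lambda1 H - \<rho>) * ?n > 0" by linarith
    then have "lambda1 H > \<rho>" by (simp add: zero_less_mult_iff)
    then show ?thesis by simp
  qed
  then show "\<rho> \<le> lambda1 H"
    and "lambda1 H = \<rho> \<Longrightarrow> graph_order H = r + 1 \<and> (\<exists>T. matching_complement H T \<and> card T = m)"
    by blast+
qed

section \<open>Construction of the extremal graph\<close>

lemma matching_complementI:
  assumes fin: "finite (pverts G)" and T: "T \<subseteq> pverts G"
    and p: "\<And>u. u \<in> T \<Longrightarrow> p u \<in> T \<and> p u \<noteq> u \<and> p (p u) = u"
    and arcs: "\<And>u v. (u, v) \<in> parcs G \<longleftrightarrow>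
      u \<in> pverts G \<and> v \<in> pverts G \<and> u \<noteq> v \<and> \<not> (u \<in> T \<and> v = p u)"
  shows "pair_graph G" "matching_complement G T"
proof -
  have "parcs G \<subseteq> pverts G \<times> pverts G" using arcs by auto
  then have "finite (parcs G)" using fin finite_subset by blast
  moreover have "symmetric (with_proj G)"
    unfolding symmetric_def
    by (rule symI) (use p in \<open>auto simp: arcs\<close>)
  ultimately show "pair_graph G"
    using fin by unfold_locales (auto simp: arcs)
  have "conbrs G u = (if u \<in> T then {p u} else {})" if "u \<in> pverts G" for u
    using that p T by (auto simp: conbrs_def arcs)
  then show "matching_complement G T"
    using T by (simp add: matching_complement_def)
qed

definition mate :: "nat \<Rightarrow> nat" where
  "mate i = (if even i then i + 1 else i - 1)"

text \<open>Evenness of \<open>m\<close> keeps the partner of an even \<open>i < m\<close> below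
  \<open>m\<close>.\<close>

lemma mate_involution:
  assumes "even m" "i < m"
  shows "mate i < m \<and> mate i \<noteq> i \<and> mate (mate i) = i"
proof (cases "even i")
  case True
  then have "i + 1 < m" using assms by presburger
  then show ?thesis using True by (simp add: mate_def)
next
  case False
  then show ?thesis using assms(2) by (auto simp: mate_def elim: oddE)
qed

text \<open>Links the involution to the \<open>div 2\<close> description of the edges of
  \<open>matching_graph\<close>.\<close>

lemma eq_mate_iff: "j = mate i \<longleftrightarrow> i \<noteq> j \<and> i div 2 = j div 2"
proof (cases "even i")
  case True
  then obtain k where "i = 2 * k" by blast
  moreover have "j = 2 * k + 1 \<longleftrightarrow> 2 * k \<noteq> j \<and> k = j div 2" by linarith
  ultimately show ?thesis by (simp add: mate_def)
next
  case False
  then obtain k where "i = 2 * k + 1" by (elim oddE)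
  moreover have "j = 2 * k \<longleftrightarrow> 2 * k + 1 \<noteq> j \<and> k = j div 2" by linarith
  ultimately show ?thesis by (simp add: mate_def)
qed

lemma extremal_graph_structure:
  fixes r m :: nat
  assumes m: "even m" "m \<le> r + 1"
  shows "pair_graph (extremal_graph r m)"
    and "matching_complement (extremal_graph r m) (Inr ` {0..<m})"
    and "graph_order (extremal_graph r m) = r + 1"
proof -
  note defs = extremal_graph_def graph_join_def graph_complement_def
    complete_graph_def matching_graph_def
  have V: "pverts (extremal_graph r m) = {0..<r + 1 - m} <+> {0..<m}"
    using m by (simp add: defs)
  have LL: "(Inl u, Inl v) \<in> parcs (extremal_graph r m) \<longleftrightarrow>
      u < r + 1 - m \<and> v < r + 1 - m \<and> u \<noteq> v" for u v
    by (auto simp: defs)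
  have RR: "(Inr u, Inr v) \<in> parcs (extremal_graph r m) \<longleftrightarrow>
      u < m \<and> v < m \<and> u \<noteq> v \<and> u div 2 \<noteq> v div 2" for u v
    using m by (auto simp: defs)
  have LR: "(Inl u, Inr v) \<in> parcs (extremal_graph r m) \<longleftrightarrow> u < r + 1 - m \<and> v < m" for u v
    using m by (auto simp: defs)
  have RL: "(Inr u, Inl v) \<in> parcs (extremal_graph r m) \<longleftrightarrow> u < m \<and> v < r + 1 - m" for u v
    using m by (auto simp: defs)
  \<comment> \<open>Only the right summand is matched in the complement; on the left,
    \<open>id\<close> is a default value outside \<open>T\<close>.\<close>
  let ?p = "map_sum id mate :: nat + nat \<Rightarrow> nat + nat"
  have arcs: "(a, b) \<in> parcs (extremal_graph r m) \<longleftrightarrow>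
      a \<in> pverts (extremal_graph r m) \<and> b \<in> pverts (extremal_graph r m) \<and> a \<noteq> b
      \<and> \<not> (a \<in> Inr ` {0..<m} \<and> b = ?p a)" for a b
    unfolding V by (cases a; cases b) (auto simp: LL RR LR RL eq_mate_iff)
  have fin: "finite (pverts (extremal_graph r m))" unfolding V by simp
  have sub: "Inr ` {0..<m} \<subseteq> pverts (extremal_graph r m)" unfolding V by auto
  have p: "?p u \<in> Inr ` {0..<m} \<and> ?p u \<noteq> u \<and> ?p (?p u) = u" if "u \<in> Inr ` {0..<m}" for u
    using that mate_involution[OF m(1)] by auto
  show "pair_graph (extremal_graph r m)" "matching_complement (extremal_graph r m) (Inr ` {0..<m})"
    by (rule matching_complementI[OF fin sub p arcs], assumption)+
  show "graph_order (extremal_graph r m) = r + 1"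
    using m by (simp add: graph_order_def V card_Plus)
qed

text \<open>A copy of the extremal graph on natural numbers: \<open>rho1\<close> ranges over such
  graphs, whereas \<open>extremal_graph\<close> has vertices in a sum type.\<close>

lemma ex_nat_matching_complement:
  assumes m: "even m" "m \<le> r + 1"
  shows "\<exists>G :: nat pair_pre_digraph. \<exists>T.
    pair_graph G \<and> matching_complement G T \<and> card T = m \<and> graph_order G = r + 1"
proof -
  define G :: "nat pair_pre_digraph" where
    "G = \<lparr>pverts = {0..<r + 1},
      parcs = {(u, v). u < r + 1 \<and> v < r + 1 \<and> u \<noteq> v \<and> \<not> (u < m \<and> v = mate u)}\<rparr>"
  have "pair_graph G" "matching_complement G {0..<m}"
    by (rule matching_complementI[where T = "{0..<m}" and p = mate];
        use mate_involution[OF m(1)] m(2) in \<open>auto simp: G_def\<close>)+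
  moreover have "graph_order G = r + 1" by (simp add: graph_order_def G_def)
  ultimately show ?thesis by (intro exI[of _ G] exI[of _ "{0..<m}"]) simp
qed

text \<open>The guard \<open>m \<noteq> r + 1\<close> sets aside the case in which the extremal
  graph is regular. Extremality is stated by isomorphism since the two vertex types differ.\<close>

theorem theorem2p1:
  fixes r m :: nat
  assumes "r \<ge> 4"
    and "even m"
    and "2 \<le> m"
    and "m \<le> r + 1"
  defines "\<rho> \<equiv> (1 / 2) * (real r - 2 + sqrt ((real r + 2)\<^sup>2 - 4 * real m))"
  shows "(m \<noteq> r + 1 \<longrightarrow> rho1 r m = \<rho> \<and> extremal_graph r m \<in> H_class r m)
    \<and> lambda1 (extremal_graph r m) = \<rho>
    \<and> (\<forall>H \<in> (H_class r m :: nat pair_pre_digraph set).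
         \<rho> \<le> lambda1 H \<and>
         (lambda1 H = \<rho> \<longleftrightarrow> digraph_iso (with_proj H) (with_proj (extremal_graph r m))))"
proof -
  let ?X = "extremal_graph r m" and ?T = "Inr ` {0..<m} :: (nat + nat) set"
  let ?s = "sqrt ((real r + 2)\<^sup>2 - 4 * real m)"
  \<comment> \<open>As \<open>(r + 2)\<^sup>2 - r\<^sup>2 = 4 * (r + 1)\<close>, this is the
    condition \<open>m \<le> r + 1\<close>; it yields \<open>?s \<ge> r\<close> and so
    \<open>\<rho> \<ge> r - 1 > 0\<close>.\<close>
  have disc: "(real r + 2)\<^sup>2 - 4 * real m \<ge> (real r)\<^sup>2"
    using assms(4) by (simp add: power2_eq_square algebra_simps)
  then have s: "?s\<^sup>2 = (real r + 2)\<^sup>2 - 4 * real m" "?s \<ge> real r"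
    using order_trans[OF zero_le_power2 disc] by (auto intro: real_le_rsqrt)
  have "?s < real r + 2"
    using assms(3) by (intro real_less_lsqrt) auto
  then have \<rho>r: "\<rho> < real r" by (simp add: \<rho>_def)
  have \<rho>0: "\<rho> > 0" using s(2) assms(1) by (simp add: \<rho>_def)
  \<comment> \<open>The factors are \<open>(r + 2 - ?s) / 2\<close> and
    \<open>(r + 2 + ?s) / 2\<close>, giving a difference of squares.\<close>
  have "(real r - \<rho>) * (\<rho> + 2) = ((real r + 2)\<^sup>2 - ?s\<^sup>2) / 4"
    by (simp add: \<rho>_def power2_eq_square field_simps)
  then have \<rho>: "(real r - \<rho>) * (\<rho> + 2) = real m" by (simp add: s(1))
  note X = extremal_graph_structure[OF assms(2,4)]
  have cardT: "card ?T = m" by (simp add: card_image)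
  have bound: "\<rho> \<le> lambda1 H" if "H \<in> H_class r m" for H :: "nat pair_pre_digraph"
    by (rule H_class_lambda1_bound(1)[OF that assms(4) \<rho> \<rho>0 \<rho>r])
  have "lambda1 ?X = \<rho>"
    by (rule lambda1_matching_complement[OF X(1,3,2) cardT \<rho> \<rho>0])
  moreover have "rho1 r m = \<rho> \<and> ?X \<in> H_class r m" if "m \<noteq> r + 1"
  proof
    have m: "m \<le> r" using that assms(4) by simp
    show "?X \<in> H_class r m"
      by (rule matching_complement_in_H_class[OF X(1,3,2) cardT assms(3) m])
    obtain G :: "nat pair_pre_digraph" and T where
      G: "pair_graph G" "graph_order G = r + 1" "matching_complement G T" "card T = m"
      using ex_nat_matching_complement[OF assms(2,4)] by blast
    have "G \<in> H_class r m"
      by (rule matching_complement_in_H_class[OF G assms(3) m])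
    moreover have "lambda1 G = \<rho>"
      by (rule lambda1_matching_complement[OF G \<rho> \<rho>0])
    ultimately show "rho1 r m = \<rho>"
      unfolding rho1_def using bound by (intro Least_equality) auto
  qed
  moreover have "lambda1 H = \<rho> \<longleftrightarrow> digraph_iso (with_proj H) (with_proj ?X)"
    if H: "H \<in> H_class r m" for H :: "nat pair_pre_digraph"
  proof
    have G: "pair_graph H" using H by (simp add: H_class_def)
    show "digraph_iso (with_proj H) (with_proj ?X)" if eq: "lambda1 H = \<rho>"
    proof -
      obtain T where "graph_order H = r + 1" "matching_complement H T" "card T = m"
        using H_class_lambda1_bound(2)[OF H assms(4) \<rho> \<rho>0 \<rho>r eq] by blast
      then show ?thesis
        using matching_complement_unique[OF G X(1) _ X(2)] X(3) cardT by simp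
    qed
    assume "digraph_iso (with_proj H) (with_proj ?X)"
    then obtain T where "matching_complement H T" "card T = m" "graph_order H = r + 1"
      using matching_complement_iso[OF G X(2)] X(3) cardT by metis
    then show "lambda1 H = \<rho>"
      using lambda1_matching_complement[OF G _ _ _ \<rho> \<rho>0] by blast
  qed
  ultimately show ?thesis using bound by blast
qed

end
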